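(* Let $N\ge 1$ be an integer and let $\omega_N=(x_1,\dots,x_N)$ be $N$ random initial states extracted independently according to the uniform probability measure $\mathbb{P}$ on $X$; let $\mathbb{P}^N$ denote the corresponding product probability measure on $X^N$. Let $O_k$, $O_\infty$, $S(k)$ ($k\in\mathbb{Z}^+$) and $t^*(\omega_N)$ be as defined in the context. Then, for any $\epsilon\in(0,1]$, $$\mathbb{P}^N\big(S(t^*(\omega_N))\ge\epsilon\big)\le \mathbb{P}^N\big(\mathbb{P}(O_{t^*(\omega_N)}\setminus O_\infty)\ge\epsilon\big)\le (1-\epsilon)^N .$$
   Context: $\mathbb{Z}^+$ denotes the set of non-negative integers. Consider the discrete-time system $x(t+1)=f(x(t))$, $t\in\mathbb{Z}^+$, where $f:\mathbb{R}^n\to\mathbb{R}^n$ is Borel measurable. $X\subseteq\mathbb{R}^n$ is a compact set of positive Lebesgue measure, and $\mathbb{P}$ is the uniform probability measure on the Borel $\sigma$-algebra of $X$. Write $\phi(t,x)$ for the state at time $t$ of the trajectory starting at $x$ at time $0$, i.e. $\phi(0,x)=x$, $\phi(t+1,x)=f(\phi(t,x))$. Define $O_0:=X$ and $O_{k+1}:=O_k\cap\{x: f(x)\in O_k\}$ for $k\in\mathbb{Z}^+$; equivalently $O_k=\{x\in X:\phi(\ell,x)\in X \text{ for all } \ell=1,\dots,k\}$. Define $O_\infty:=\{x\in\mathbb{R}^n:\phi(k,x)\in X\text{ for all }k\in\mathbb{Z}^+\}$ and $S(k):=\mathbb{P}(O_k\setminus O_{k+1})$ for $k\in\mathbb{Z}^+$.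 For $x\in X$, let $t^*(x):=\min\{t\in\mathbb{Z}^+:\phi(t,x)\notin X\}$ if this set is nonempty, and $t^*(x):=0$ if $\phi(t,x)\in X$ for all $t\in\mathbb{Z}^+$. For $\omega_N=(x_1,\dots,x_N)\in X^N$, let $t^*(\omega_N):=\max_{1\le i\le N}t^*(x_i)$. *)

theory Defs
  imports "HOL-Probability.Probability"
begin

primrec trajectory :: "('a \<Rightarrow> 'a) \<Rightarrow> nat \<Rightarrow> 'a \<Rightarrow> 'a" where
  "trajectory f 0 x = x"
| "trajectory f (Suc t) x = f (trajectory f t x)"

primrec O_fin :: "('a \<Rightarrow> 'a) \<Rightarrow> 'a set \<Rightarrow> nat \<Rightarrow> 'a set" where
  "O_fin f X 0 = X"
| "O_fin f X (Suc k) = O_fin f X k \<inter> {x. f x \<in> O_fin f X k}"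

definition O_inf :: "('a \<Rightarrow> 'a) \<Rightarrow> 'a set \<Rightarrow> 'a set" where
  "O_inf f X = {x. \<forall>k. trajectory f k x \<in> X}"

text \<open>The space of this measure is \<open>X\<close> itself, with the Borel subsets of \<open>X\<close> as its
  \<open>\<sigma>\<close>-algebra.\<close>

definition uniform_on :: "'a::euclidean_space set \<Rightarrow> 'a measure" where
  "uniform_on X = uniform_measure (restrict_space lborel X) X"

definition S_fun :: "('a::euclidean_space \<Rightarrow> 'a) \<Rightarrow> 'a set \<Rightarrow> nat \<Rightarrow> real" where
  "S_fun f X k = measure (uniform_on X) (O_fin f X k - O_fin f X (Suc k))"

definition t_star :: "('a \<Rightarrow> 'a) \<Rightarrow> 'a set \<Rightarrow> 'a \<Rightarrow> nat" where
  "t_star f X x =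
     (if \<exists>t. trajectory f t x \<notin> X then LEAST t. trajectory f t x \<notin> X else 0)"

definition t_star_sample :: "('a \<Rightarrow> 'a) \<Rightarrow> 'a set \<Rightarrow> nat \<Rightarrow> (nat \<Rightarrow> 'a) \<Rightarrow> nat" where
  "t_star_sample f X N \<omega> = Max ((\<lambda>i. t_star f X (\<omega> i)) ` {1..N})"

text \<open>Samples of size \<open>N\<close> are extensional functions on the index set \<open>{1..N}\<close>.\<close>

definition sample_measure :: "'a::euclidean_space set \<Rightarrow> nat \<Rightarrow> (nat \<Rightarrow> 'a) measure" where
  "sample_measure X N = Pi\<^sub>M {1..N} (\<lambda>_. uniform_on X)"

end

theory Submission
  imports Defs
begin

text \<open>Put \<open>V k = P (O\<^sub>k - O\<^sub>\<infinity>)\<close>, which decreases to \<open>0\<close>, so for \<open>\<epsilon> > 0\<close> the set of \<open>k\<close> with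
  \<open>V k \<ge> \<epsilon>\<close> is either empty or \<open>{0..m}\<close> for some \<open>m\<close>. A point \<open>x\<close> satisfies \<open>t\<^sup>*(x) > m\<close>
  exactly when it lies in \<open>O\<^sub>m - O\<^sub>\<infinity>\<close>; thus the second event is empty or says that all \<open>N\<close>
  independent points avoid \<open>O\<^sub>m - O\<^sub>\<infinity>\<close>, which has probability \<open>(1 - V m)\<^sup>N \<le> (1 - \<epsilon>)\<^sup>N\<close>.
  The first inequality holds because \<open>O\<^sub>\<infinity> \<subseteq> O\<^bsub>k+1\<^esub>\<close> gives \<open>S k \<le> V k\<close>.\<close>

text \<open>\<open>trajectory\<close> applies \<open>f\<close> last, while the recursion of
  \<open>O_fin\<close> tests \<open>f x\<close> and so applies it first; this identity reconciles
  the two.\<close>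

lemma trajectory_shift: "trajectory f k (f x) = trajectory f (Suc k) x"
  by (induction k) auto

lemma mem_O_fin_iff: "x \<in> O_fin f X k \<longleftrightarrow> (\<forall>l\<le>k. trajectory f l x \<in> X)"
proof (induction k arbitrary: x)
  case 0
  show ?case by simp
next
  case (Suc k)
  have "x \<in> O_fin f X (Suc k) \<longleftrightarrow>
      (\<forall>l\<le>k. trajectory f l x \<in> X) \<and> (\<forall>l\<le>k. trajectory f (Suc l) x \<in> X)"
    by (simp add: Suc.IH trajectory_shift del: trajectory.simps)
  also have "\<dots> \<longleftrightarrow> (\<forall>l\<le>Suc k. trajectory f l x \<in> X)"
  proof (intro iffI conjI allI impI)
    fix l
    assume "(\<forall>l\<le>k. trajectory f l x \<in> X) \<and> (\<forall>l\<le>k. trajectory f (Suc l) x \<in> X)"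
      and "l \<le> Suc k"
    then show "trajectory f l x \<in> X"
      \<comment> \<open>For \<open>l = Suc k\<close> the second conjunct is used at index
        \<open>k\<close>.\<close>
      by (cases "l \<le> k") (auto simp: le_Suc_eq)
  qed (simp_all del: trajectory.simps)
  finally show ?case .
qed

lemma decseq_O_fin: "decseq (O_fin f X)"
  by (rule decseq_SucI) auto

lemma O_fin_subset: "O_fin f X k \<subseteq> X"
  using decseqD[OF decseq_O_fin, of 0 k f X] by simp

text \<open>As a countable intersection, \<open>O_inf\<close> inherits measurability from the sets
  \<open>O_fin\<close>, and the differences \<open>O_fin f X k - O_inf f X\<close> shrink to the
  empty set.\<close>

lemma O_inf_eq_INT: "O_inf f X = (\<Inter>k. O_fin f X k)"
  by (auto simp: O_inf_def mem_O_fin_iff, blast)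

text \<open>If the trajectory leaves \<open>X\<close>, then \<open>t_star\<close> is the first exit
  time, which exceeds \<open>m\<close> iff no exit occurs up to time \<open>m\<close>. If it never
  leaves, both sides are false: the left by the default value 0, the right because \<open>x\<close>
  lies in \<open>O_inf\<close>.\<close>

lemma less_t_star_iff:
  "m < t_star f X x \<longleftrightarrow> x \<in> O_fin f X m - O_inf f X"
proof (cases "\<exists>t. trajectory f t x \<notin> X")
  case True
  let ?t = "LEAST t. trajectory f t x \<notin> X"
  have out: "trajectory f ?t x \<notin> X"
    using True by (rule LeastI_ex)
  have "m < ?t \<longleftrightarrow> (\<forall>l\<le>m. trajectory f l x \<in> X)"
  proof (intro iffI allI impI)
    fix l assume "m < ?t" and "l \<le> m"
    then have "l < ?t" by simp
    then show "trajectory f l x \<in> X"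
      using not_less_Least[of l "\<lambda>t. trajectory f t x \<notin> X"] by blast
  next
    assume "\<forall>l\<le>m. trajectory f l x \<in> X"
    with out show "m < ?t" using not_le by blast
  qed
  moreover have "t_star f X x = ?t"
    using True by (simp only: t_star_def if_True)
  moreover have "x \<notin> O_inf f X"
    using True by (simp add: O_inf_def)
  ultimately show ?thesis
    by (simp only: mem_O_fin_iff Diff_iff simp_thms)
next
  case False
  then show ?thesis
    by (simp add: t_star_def O_inf_def)
qed

lemma t_star_sample_le_iff:
  assumes "N \<ge> 1"
  shows "t_star_sample f X N \<omega> \<le> m \<longleftrightarrow> (\<forall>i\<in>{1..N}. t_star f X (\<omega> i) \<le> m)"
  unfolding t_star_sample_def using assms by (subst Max_le_iff) auto

lemma O_fin_borel:
  fixes f :: "'a::topological_space \<Rightarrow> 'a"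
  assumes "f \<in> borel_measurable borel" "X \<in> sets borel"
  shows "O_fin f X k \<in> sets borel"
proof (induction k)
  case (Suc k)
  have "f -` O_fin f X k \<inter> space borel \<in> sets borel"
    using assms(1) Suc by (rule measurable_sets)
  then show ?case
    using Suc by (simp add: vimage_def)
qed (simp add: assms)

lemma space_uniform_on: "space (uniform_on X) = X"
  by (simp add: uniform_on_def space_restrict_space)

lemma sets_uniform_onI:
  assumes "A \<in> sets borel" "A \<subseteq> X"
  shows "A \<in> sets (uniform_on X)"
  using assms by (auto simp: uniform_on_def sets_restrict_space)

text \<open>Normalization is possible because the volume of \<open>X\<close> is positive by
  assumption and finite by compactness.\<close>

lemma prob_space_uniform_on:
  fixes X :: "'a::euclidean_space set"
  assumes "compact X" "emeasure lborel X > 0"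
  shows "prob_space (uniform_on X)"
proof -
  have X: "X \<in> sets borel"
    using assms(1) by (simp add: borel_compact)
  have "emeasure (restrict_space lborel X) X = emeasure lborel X"
    using X by (intro emeasure_restrict_space) auto
  moreover have "emeasure lborel X < \<infinity>"
    using assms(1) by (rule emeasure_compact_finite)
  ultimately show ?thesis
    unfolding uniform_on_def using assms(2) by (intro prob_space_uniform_measure) auto
qed

text \<open>Independence: the product measure of a box is the product of the measures of its sides,
  here all equal.\<close>

lemma prob_all_in:
  fixes I :: "'i set"
  assumes "prob_space M" "finite I" "A \<in> sets M"
  shows "measure (Pi\<^sub>M I (\<lambda>_. M)) (Pi\<^sub>E I (\<lambda>_. A)) = measure M A ^ card I"
proof -
  interpret M: prob_space M by fact
  interpret product_prob_space "\<lambda>_::'i. M" I by unfold_locales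
  interpret finite_product_prob_space "\<lambda>_::'i. M" I
    by unfold_locales fact
  show ?thesis
    using assms(3) by (simp add: finite_measure_PiM_emb)
qed

theorem theorem2:
  fixes f :: "real ^ 'n \<Rightarrow> real ^ 'n"
    and X :: "(real ^ 'n) set"
    and N :: nat
    and \<epsilon> :: real
  assumes "f \<in> borel_measurable borel"
    and "compact X"
    and "emeasure lborel X > 0"
    and "N \<ge> 1"
    and "0 < \<epsilon>" and "\<epsilon> \<le> 1"
  shows "measure (sample_measure X N)
           {\<omega> \<in> space (sample_measure X N). S_fun f X (t_star_sample f X N \<omega>) \<ge> \<epsilon>}
         \<le> measure (sample_measure X N)
           {\<omega> \<in> space (sample_measure X N).
              measure (uniform_on X) (O_fin f X (t_star_sample f X N \<omega>) - O_inf f X) \<ge> \<epsilon>}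
       \<and> measure (sample_measure X N)
           {\<omega> \<in> space (sample_measure X N).
              measure (uniform_on X) (O_fin f X (t_star_sample f X N \<omega>) - O_inf f X) \<ge> \<epsilon>}
         \<le> (1 - \<epsilon>) ^ N"
proof -
  define M where "M = uniform_on X"
  define P where "P = sample_measure X N"
  define D where "D k = O_fin f X k - O_inf f X" for k
  define V where "V k = measure M (D k)" for k
  define T where "T = t_star_sample f X N"
  interpret M: prob_space M
    unfolding M_def using assms(2,3) by (rule prob_space_uniform_on)
  have P_eq: "P = Pi\<^sub>M {1..N} (\<lambda>_. M)"
    by (simp add: P_def sample_measure_def M_def)
  interpret P: prob_space P
    unfolding P_eq by (intro prob_space_PiM M.prob_space_axioms)
  have "X \<in> sets borel"
    using assms(2) by (simp add: borel_compact)
  then have O_fin_M: "O_fin f X k \<in> sets M" for k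
    unfolding M_def using assms(1) by (intro sets_uniform_onI O_fin_borel O_fin_subset)
  then have D_M: "D k \<in> sets M" for k
    unfolding D_def O_inf_eq_INT by (intro sets.Diff sets.countable_INT) auto
  have D_decseq: "decseq D"
    by (rule decseq_SucI) (auto simp: D_def)
  have V_antimono: "V j \<le> V i" if "i \<le> j" for i j
    unfolding V_def using D_M decseqD[OF D_decseq that] by (intro M.finite_measure_mono) auto
  have "(\<Inter>k. D k) = {}"
    by (auto simp: D_def O_inf_eq_INT)
  \<comment> \<open>Continuity from above along the decreasing sets \<open>D k\<close>.\<close>
  then have V_tendsto: "V \<longlonglongrightarrow> 0"
    unfolding V_def using M.finite_Lim_measure_decseq[OF _ D_decseq] D_M by auto
  have S_le_V: "S_fun f X k \<le> V k" for k
    unfolding S_fun_def V_def M_def[symmetric]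
    using D_M by (intro M.finite_measure_mono) (auto simp: D_def O_inf_eq_INT simp del: O_fin.simps)

  let ?E = "{\<omega> \<in> space P. \<epsilon> \<le> V (T \<omega>)}"
  \<comment> \<open>Measurability is carried along because the first inequality follows by
    monotonicity, which asks for it on the larger event.\<close>
  have E: "?E \<in> sets P \<and> measure P ?E \<le> (1 - \<epsilon>) ^ N"
  proof (cases "V 0 \<ge> \<epsilon>")
    case False
    then have E_empty: "?E = {}"
      using V_antimono[of 0] by (auto simp: not_le intro: order.strict_trans1)
    show ?thesis
      unfolding E_empty using assms(6) by simp
  next
    case True
    obtain n where n: "V n < \<epsilon>"
      using eventually_happens'[OF sequentially_bot order_tendstoD(2)[OF V_tendsto assms(5)]] ..
    \<comment> \<open>This bound, together with the witness 0 from the case assumption, makes the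
      \<open>GREATEST\<close> below well defined.\<close>
    have bound: "k \<le> n" if "\<epsilon> \<le> V k" for k
      using that n V_antimono[of n k] by linarith
    define m where "m = (GREATEST k. \<epsilon> \<le> V k)"
    have m: "\<epsilon> \<le> V m"
      unfolding m_def using True bound by (rule GreatestI_nat)
    have "k \<le> m" if "\<epsilon> \<le> V k" for k
      unfolding m_def using that bound by (rule Greatest_le_nat)
    then have V_iff: "\<epsilon> \<le> V k \<longleftrightarrow> k \<le> m" for k
      using m V_antimono[of k m] by force
    have sp: "space M = X"
      by (simp add: M_def space_uniform_on)
    have t_le: "t_star f X x \<le> m \<longleftrightarrow> x \<notin> D m" for x
      using less_t_star_iff[of m f X x] unfolding D_def by linarith
    \<comment> \<open>The maximum of the exit times is at most \<open>m\<close> iff each one is, so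
      the event splits into one condition per coordinate.\<close>
    have E_eq: "?E = Pi\<^sub>E {1..N} (\<lambda>_. space M - D m)"
      unfolding P_eq space_PiM sp V_iff T_def t_star_sample_le_iff[OF assms(4)]
      using t_le by (auto simp: PiE_iff extensional_def simp del: atLeastAtMost_iff)
    have "?E \<in> sets P"
      unfolding E_eq unfolding P_eq using D_M by (intro sets_PiM_I_finite) auto
    moreover have "measure P ?E = (1 - V m) ^ N"
      unfolding E_eq unfolding P_eq V_def using D_M
      by (simp add: prob_all_in[OF M.prob_space_axioms] M.prob_compl)
    moreover have "(1 - V m) ^ N \<le> (1 - \<epsilon>) ^ N"
      using m by (intro power_mono) (auto simp: V_def)
    ultimately show ?thesis
      by simp
  qed
  moreover have "measure P {\<omega> \<in> space P. \<epsilon> \<le> S_fun f X (T \<omega>)} \<le> measure P ?E"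
    using E S_le_V by (intro P.finite_measure_mono) (auto intro: order_trans)
  ultimately show ?thesis
    by (simp add: P_def V_def D_def M_def T_def)
qed

end
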